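(* Let $L$ be a sublattice of $2^{[r]}$ (i.e. a family of subsets of $[r]$ closed under union and intersection) that contains both $\emptyset$ and $[r]$. (1) There is a rank-$r$ transversal matroid $M$ and a maximal presentation $\mathcal{A}$ of $M$ with $L=L_\mathcal{A}$. (2) For any $n\ge r$, there is a presentation $\mathcal{B}$ of the uniform matroid $U_{r,n}$ with $L=L_\mathcal{B}$.
   Context: $[r]=\{1,\dots,r\}$. For a set system $\mathcal{A}=(A_i:i\in[r])$ on a finite set $E$, $M[\mathcal{A}]$ is the transversal matroid on $E$ whose independent sets are the partial transversals of $\mathcal{A}$ (sets $X$ admitting an injection $\phi:X\to[r]$ with $e\in A_{\phi(e)}$); $\mathcal{A}$ is a presentation of $M[\mathcal{A}]$; presentations of a rank-$r$ matroid have exactly $r$ sets. Presentations of $M$ are ordered by $(A_i)\preceq(B_i)$ iff $A_i\subseteq B_i$ for all $i$; maximal means maximal in this order. Fix $x\notin E$; for $I\subseteq[r]$, $\mathcal{A}^I$ is obtained from $\mathcal{A}$ by replacing $A_i$ by $A_i\cup\{x\}$ for each $i\in I$. Let $\sigma_\mathcal{A}(I)=I\cup\{k\in[r]-I: x\text{ is a coloop of } M[\mathcal{A}^I]\backslash A_k\}$; $L_\mathcal{A}$ is the set of $I\subseteq[r]$ with $\sigma_\mathcal{A}(I)=I$. *)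

theory Defs
  imports Main
begin

text \<open>A matroid is represented by the pair of its ground set and its collection of
  independent sets; the axioms are the predicate \<open>is_matroid\<close>.\<close>

type_synonym 'a matroid_data = "'a set \<times> 'a set set"

definition ground :: "'a matroid_data \<Rightarrow> 'a set" where
  "ground M = fst M"

definition indeps :: "'a matroid_data \<Rightarrow> 'a set set" where
  "indeps M = snd M"

definition is_matroid :: "'a matroid_data \<Rightarrow> bool" where
  "is_matroid M \<longleftrightarrow>
     finite (ground M) \<and>
     indeps M \<subseteq> Pow (ground M) \<and>
     {} \<in> indeps M \<and>
     (\<forall>Y\<in>indeps M. \<forall>X. X \<subseteq> Y \<longrightarrow> X \<in> indeps M) \<and>
     (\<forall>X\<in>indeps M. \<forall>Y\<in>indeps M. card X < card Y \<longrightarrow>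
        (\<exists>y\<in>Y - X. insert y X \<in> indeps M))"

definition mrank :: "'a matroid_data \<Rightarrow> nat" where
  "mrank M = Max (card ` indeps M)"

definition is_basis :: "'a matroid_data \<Rightarrow> 'a set \<Rightarrow> bool" where
  "is_basis M B \<longleftrightarrow> B \<in> indeps M \<and> (\<forall>B'\<in>indeps M. B \<subseteq> B' \<longrightarrow> B' = B)"

definition coloop :: "'a matroid_data \<Rightarrow> 'a \<Rightarrow> bool" where
  "coloop M e \<longleftrightarrow> e \<in> ground M \<and> (\<forall>B. is_basis M B \<longrightarrow> e \<in> B)"

definition deletion :: "'a matroid_data \<Rightarrow> 'a set \<Rightarrow> 'a matroid_data" where
  "deletion M D = (ground M - D, {X \<in> indeps M. X \<subseteq> ground M - D})"

definition uniform_matroid :: "nat \<Rightarrow> 'a set \<Rightarrow> 'a matroid_data" where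
  "uniform_matroid r E = (E, {X. X \<subseteq> E \<and> card X \<le> r})"

text \<open>A set system \<open>(A\<^sub>i : i \<in> [r])\<close> is a function on \<open>nat\<close> of which only the values at
  \<open>1, \<dots>, r\<close> matter.\<close>

definition set_system :: "'a set \<Rightarrow> nat \<Rightarrow> (nat \<Rightarrow> 'a set) \<Rightarrow> bool" where
  "set_system E r A \<longleftrightarrow> finite E \<and> (\<forall>i\<in>{1..r}. A i \<subseteq> E)"

definition partial_transversal :: "nat \<Rightarrow> (nat \<Rightarrow> 'a set) \<Rightarrow> 'a set \<Rightarrow> bool" where
  "partial_transversal r A X \<longleftrightarrow>
     (\<exists>\<phi>. inj_on \<phi> X \<and> \<phi> ` X \<subseteq> {1..r} \<and> (\<forall>e\<in>X. e \<in> A (\<phi> e)))"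

definition transversal_matroid :: "'a set \<Rightarrow> nat \<Rightarrow> (nat \<Rightarrow> 'a set) \<Rightarrow> 'a matroid_data" where
  "transversal_matroid E r A = (E, {X. X \<subseteq> E \<and> partial_transversal r A X})"

definition is_transversal_matroid :: "'a matroid_data \<Rightarrow> bool" where
  "is_transversal_matroid M \<longleftrightarrow>
     (\<exists>s A. set_system (ground M) s A \<and> M = transversal_matroid (ground M) s A)"

text \<open>Presentations are required to have as many sets as the rank of the matroid.\<close>

definition presentation :: "nat \<Rightarrow> (nat \<Rightarrow> 'a set) \<Rightarrow> 'a matroid_data \<Rightarrow> bool" where
  "presentation r A M \<longleftrightarrow>
     mrank M = r \<and> set_system (ground M) r A \<and> M = transversal_matroid (ground M) r A"

definition sys_le :: "nat \<Rightarrow> (nat \<Rightarrow> 'a set) \<Rightarrow> (nat \<Rightarrow> 'a set) \<Rightarrow> bool" where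
  "sys_le r A B \<longleftrightarrow> (\<forall>i\<in>{1..r}. A i \<subseteq> B i)"

definition maximal_presentation :: "nat \<Rightarrow> (nat \<Rightarrow> 'a set) \<Rightarrow> 'a matroid_data \<Rightarrow> bool" where
  "maximal_presentation r A M \<longleftrightarrow>
     presentation r A M \<and>
     (\<forall>B. presentation r B M \<and> sys_le r A B \<longrightarrow> (\<forall>i\<in>{1..r}. B i = A i))"

definition extend_system :: "'a \<Rightarrow> nat set \<Rightarrow> (nat \<Rightarrow> 'a set) \<Rightarrow> nat \<Rightarrow> 'a set" where
  "extend_system x I A = (\<lambda>i. if i \<in> I then insert x (A i) else A i)"

text \<open>In the next two definitions, \<open>x\<close> is meant to lie outside \<open>E\<close>, and the extended system lives
  on the ground set \<open>insert x E\<close>.\<close>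

definition sigma_op :: "'a set \<Rightarrow> nat \<Rightarrow> 'a \<Rightarrow> (nat \<Rightarrow> 'a set) \<Rightarrow> nat set \<Rightarrow> nat set" where
  "sigma_op E r x A I = I \<union> {k \<in> {1..r} - I.
     coloop (deletion (transversal_matroid (insert x E) r (extend_system x I A)) (A k)) x}"

definition closed_sets :: "'a set \<Rightarrow> nat \<Rightarrow> 'a \<Rightarrow> (nat \<Rightarrow> 'a set) \<Rightarrow> nat set set" where
  "closed_sets E r x A = {I. I \<subseteq> {1..r} \<and> sigma_op E r x A I = I}"

definition sublattice_of_subsets :: "nat \<Rightarrow> nat set set \<Rightarrow> bool" where
  "sublattice_of_subsets r L \<longleftrightarrow>
     L \<subseteq> Pow {1..r} \<and> (\<forall>I\<in>L. \<forall>J\<in>L. I \<union> J \<in> L \<and> I \<inter> J \<in> L)"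

lemma is_matroidI:
  assumes "finite E" and "P {}"
    and "\<And>X Y. X \<subseteq> Y \<Longrightarrow> Y \<subseteq> E \<Longrightarrow> P Y \<Longrightarrow> P X"
    and "\<And>X Y. X \<subseteq> E \<Longrightarrow> P X \<Longrightarrow> Y \<subseteq> E \<Longrightarrow> P Y \<Longrightarrow> card X < card Y \<Longrightarrow>
           \<exists>y\<in>Y - X. P (insert y X)"
  shows "is_matroid (E, {X. X \<subseteq> E \<and> P X})"
  unfolding is_matroid_def ground_def indeps_def fst_conv snd_conv
proof (intro conjI ballI allI impI)
  show "X \<in> {X. X \<subseteq> E \<and> P X}" if "Y \<in> {X. X \<subseteq> E \<and> P X}" "X \<subseteq> Y" for X Y
    using that assms(3)[of X Y] by auto
  show "\<exists>y\<in>Y - X. insert y X \<in> {X. X \<subseteq> E \<and> P X}"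
    if "X \<in> {X. X \<subseteq> E \<and> P X}" "Y \<in> {X. X \<subseteq> E \<and> P X}" "card X < card Y" for X Y
  proof -
    have "\<exists>y\<in>Y - X. P (insert y X)"
      using that by (intro assms(4)) simp_all
    then obtain y where "y \<in> Y - X" "P (insert y X)" by (rule bexE)
    then show ?thesis using that(1,2) by (intro bexI[of _ y]) auto
  qed
qed (use assms(1,2) in auto)

lemma partial_transversal_subset:
  assumes "partial_transversal r A Y" "X \<subseteq> Y"
  shows "partial_transversal r A X"
proof -
  obtain \<phi> where \<phi>: "inj_on \<phi> Y" "\<phi> ` Y \<subseteq> {1..r}" "\<forall>e\<in>Y. e \<in> A (\<phi> e)"
    using assms(1) unfolding partial_transversal_def by blast
  have "inj_on \<phi> X" using \<phi>(1) assms(2) by (rule inj_on_subset)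
  moreover have "\<phi> ` X \<subseteq> {1..r}" using \<phi>(2) assms(2) by blast
  moreover have "\<forall>e\<in>X. e \<in> A (\<phi> e)" using \<phi>(3) assms(2) by blast
  ultimately show ?thesis unfolding partial_transversal_def by blast
qed

lemma partial_transversal_augment:
  assumes fin: "finite X" "finite Y" and lt: "card X < card Y"
    and \<psi>: "inj_on \<psi> Y" "\<psi> ` Y \<subseteq> {1..r}" "\<forall>e\<in>Y. e \<in> A (\<psi> e)"
    and \<phi>: "inj_on \<phi> X" "\<phi> ` X \<subseteq> {1..r}" "\<forall>e\<in>X. e \<in> A (\<phi> e)"
  shows "\<exists>y\<in>Y - X. partial_transversal r A (insert y X)"
  using \<phi>
proof (induction "card {e \<in> X \<inter> Y. \<phi> e \<noteq> \<psi> e}" arbitrary: \<phi> rule: less_induct)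
  case less
  have "card (\<phi> ` X) < card (\<psi> ` Y)"
    using less.prems(1) \<psi>(1) lt by (simp add: card_image)
  then have "\<not> \<psi> ` Y \<subseteq> \<phi> ` X"
    using fin by (meson card_mono finite_imageI not_le)
  then obtain y where y: "y \<in> Y" "\<psi> y \<notin> \<phi> ` X" by blast
  define \<phi>' where "\<phi>' = \<phi>(y := \<psi> y)"
  have inj: "inj_on \<phi>' (insert y X)"
  proof (rule inj_onI)
    fix a b assume ab: "a \<in> insert y X" "b \<in> insert y X" "\<phi>' a = \<phi>' b"
    show "a = b"
    proof (cases "a = y \<or> b = y")
      case True
      have "\<phi> c \<noteq> \<psi> y" if "c \<in> X" for c using y(2) that by (metis imageI)
      then show ?thesis using True ab by (fastforce simp: \<phi>'_def split: if_splits)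
    next
      case False
      then have "a \<in> X" "b \<in> X" "\<phi> a = \<phi> b" using ab by (auto simp: \<phi>'_def)
      then show ?thesis using less.prems(1) by (simp add: inj_on_eq_iff)
    qed
  qed
  have rng: "\<phi>' ` insert y X \<subseteq> {1..r}"
  proof (rule image_subsetI)
    fix a assume "a \<in> insert y X"
    then show "\<phi>' a \<in> {1..r}"
      using subsetD[OF less.prems(2), of "\<phi> a"] subsetD[OF \<psi>(2), of "\<psi> y"] y(1)
      by (cases "a = y") (simp_all add: \<phi>'_def)
  qed
  have mem: "\<forall>e\<in>insert y X. e \<in> A (\<phi>' e)"
    using less.prems(3) \<psi>(3) y(1) by (simp add: \<phi>'_def)
  show ?case
  proof (cases "y \<in> X")
    case False
    then show ?thesis
      using inj rng mem y(1) unfolding partial_transversal_def by blast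
  next
    case True
    have "{e \<in> X \<inter> Y. \<phi>' e \<noteq> \<psi> e} \<subset> {e \<in> X \<inter> Y. \<phi> e \<noteq> \<psi> e}"
    proof (rule psubsetI)
      show "{e \<in> X \<inter> Y. \<phi>' e \<noteq> \<psi> e} \<subseteq> {e \<in> X \<inter> Y. \<phi> e \<noteq> \<psi> e}"
        by (auto simp: \<phi>'_def split: if_splits)
      have "\<phi> y \<noteq> \<psi> y" using True y(2) by (metis imageI)
      then have "y \<in> {e \<in> X \<inter> Y. \<phi> e \<noteq> \<psi> e}" using True y(1) by simp
      moreover have "y \<notin> {e \<in> X \<inter> Y. \<phi>' e \<noteq> \<psi> e}" by (simp add: \<phi>'_def)
      ultimately show "{e \<in> X \<inter> Y. \<phi>' e \<noteq> \<psi> e} \<noteq> {e \<in> X \<inter> Y. \<phi> e \<noteq> \<psi> e}" by metis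
    qed
    then have "card {e \<in> X \<inter> Y. \<phi>' e \<noteq> \<psi> e} < card {e \<in> X \<inter> Y. \<phi> e \<noteq> \<psi> e}"
      using fin by (intro psubset_card_mono) auto
    then show ?thesis
      using less.hyps[of \<phi>'] inj rng mem unfolding insert_absorb[OF True] by blast
  qed
qed

lemma is_matroid_transversal_matroid:
  assumes "set_system E r A"
  shows "is_matroid (transversal_matroid E r A)"
  unfolding transversal_matroid_def
proof (rule is_matroidI)
  show fin: "finite E" using assms by (simp add: set_system_def)
  show "partial_transversal r A {}" by (simp add: partial_transversal_def)
  show "partial_transversal r A X" if "X \<subseteq> Y" "partial_transversal r A Y" for X Y
    using partial_transversal_subset[OF that(2,1)] .
  show "\<exists>y\<in>Y - X. partial_transversal r A (insert y X)"
    if X: "X \<subseteq> E" "partial_transversal r A X"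
      and Y: "Y \<subseteq> E" "partial_transversal r A Y" and lt: "card X < card Y" for X Y
  proof -
    have fXY: "finite X" "finite Y" using fin X(1) Y(1) finite_subset by auto
    obtain \<phi> where \<phi>: "inj_on \<phi> X" "\<phi> ` X \<subseteq> {1..r}" "\<forall>e\<in>X. e \<in> A (\<phi> e)"
      using X(2) unfolding partial_transversal_def by blast
    obtain \<psi> where \<psi>: "inj_on \<psi> Y" "\<psi> ` Y \<subseteq> {1..r}" "\<forall>e\<in>Y. e \<in> A (\<psi> e)"
      using Y(2) unfolding partial_transversal_def by blast
    show ?thesis
      by (rule partial_transversal_augment[OF fXY lt \<psi> \<phi>])
  qed
qed

lemma is_matroid_uniform_matroid:
  assumes "finite E"
  shows "is_matroid (uniform_matroid r E)"
  unfolding uniform_matroid_def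
proof (rule is_matroidI)
  show "card X \<le> r" if "X \<subseteq> Y" "Y \<subseteq> E" "card Y \<le> r" for X Y
    using card_mono[OF finite_subset[OF that(2) assms] that(1)] that(3) by linarith
  show "\<exists>y\<in>Y - X. card (insert y X) \<le> r"
    if "X \<subseteq> E" "card Y \<le> r" "card X < card Y" for X Y
  proof -
    have fX: "finite X" using finite_subset[OF that(1) assms] .
    then have "\<not> Y \<subseteq> X" using that(3) card_mono[OF fX, of Y] by linarith
    then obtain y where y: "y \<in> Y - X" by blast
    then have "card (insert y X) \<le> r" using that(2,3) fX by simp
    then show ?thesis using y by blast
  qed
qed (use assms in auto)

end

theory Submission imports Defs "HOL.Hull" begin

text \<open>Write \<open>s(X)\<close> for the set of indices \<open>i \<in> [r]\<close> with \<open>X \<inter> A\<^sub>i \<noteq> {}\<close>. If \<open>E - A\<^sub>k\<close> contains a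
  partial transversal with \<open>|s(E - A\<^sub>k)|\<close> elements, then \<open>x\<close> is a coloop of \<open>M[A\<^sup>I]\A\<^sub>k\<close> iff \<open>I\<close> is
  not contained in \<open>s(E - A\<^sub>k)\<close>: an index in \<open>I - s(E - A\<^sub>k)\<close> is always free for \<open>x\<close>, and if there
  is none, then the large partial transversal leaves no index for \<open>x\<close>.

  To realize \<open>L\<close>, label every \<open>e \<in> E\<close> with a member of \<open>L\<close> and let \<open>A\<^sub>i\<close> consist of the elements
  whose label contains \<open>i\<close>. If for every \<open>i \<in> [r]\<close> the least member of \<open>L\<close> containing \<open>i\<close> is the
  label of some \<open>e\<^sub>i\<close>, all \<open>e\<^sub>i\<close> being distinct, then \<open>s(E - A\<^sub>k)\<close> is the greatest member of \<open>L\<close>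
  avoiding \<open>k\<close>, and the \<open>e\<^sub>i\<close> with \<open>i \<in> s(E - A\<^sub>k)\<close> are a partial transversal as required.
  So \<open>I\<close> is closed iff for every \<open>k\<close> outside \<open>I\<close> some member of \<open>L\<close> contains \<open>I\<close> and avoids \<open>k\<close>,
  which says that \<open>I\<close> is an intersection of members of \<open>L\<close>, hence itself a member.

  Having every \<open>e\<^sub>i\<close> twice makes the presentation maximal; labelling all elements besides the \<open>e\<^sub>i\<close>
  with \<open>[r]\<close> makes the matroid uniform.\<close>

subsection \<open>Matchings and supports\<close>

definition matching :: "nat \<Rightarrow> (nat \<Rightarrow> 'a set) \<Rightarrow> 'a set \<Rightarrow> ('a \<Rightarrow> nat) \<Rightarrow> bool" where
  "matching r A X \<phi> \<longleftrightarrow> inj_on \<phi> X \<and> \<phi> ` X \<subseteq> {1..r} \<and> (\<forall>e\<in>X. e \<in> A (\<phi> e))"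

definition support :: "nat \<Rightarrow> (nat \<Rightarrow> 'a set) \<Rightarrow> 'a set \<Rightarrow> nat set" where
  "support r A X = {i \<in> {1..r}. X \<inter> A i \<noteq> {}}"

lemma partial_transversal_iff_matching: "partial_transversal r A X \<longleftrightarrow> (\<exists>\<phi>. matching r A X \<phi>)"
  by (simp add: partial_transversal_def matching_def)

lemma finite_support: "finite (support r A X)"
  by (simp add: support_def)

lemma support_subset: "support r A X \<subseteq> {1..r}"
  by (auto simp: support_def)

lemma support_mono: "X \<subseteq> Y \<Longrightarrow> support r A X \<subseteq> support r A Y"
  by (auto simp: support_def)

lemma matching_image_subset_support: "matching r A X \<phi> \<Longrightarrow> \<phi> ` X \<subseteq> support r A X"
  by (auto simp: matching_def support_def)

lemma card_matching_image: "matching r A X \<phi> \<Longrightarrow> card (\<phi> ` X) = card X"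
  by (simp add: matching_def card_image)

lemma matching_mono: "matching r A X \<phi> \<Longrightarrow> sys_le r A B \<Longrightarrow> matching r B X \<phi>"
  by (auto simp: matching_def sys_le_def)

lemma partial_transversal_mono:
  "partial_transversal r A X \<Longrightarrow> sys_le r A B \<Longrightarrow> partial_transversal r B X"
  unfolding partial_transversal_iff_matching using matching_mono by blast

lemma partial_transversal_insert_matching:
  assumes "matching r A X \<phi>" and "i \<in> {1..r} - \<phi> ` X" and "x \<in> A i"
  shows "partial_transversal r A (insert x X)"
proof (cases "x \<in> X")
  case True
  then show ?thesis
    using assms(1) by (auto simp: partial_transversal_iff_matching insert_absorb)
next
  case False
  then have "matching r A (insert x X) (\<phi>(x := i))"
    using assms by (auto simp: matching_def inj_on_def)
  then show ?thesis by (auto simp: partial_transversal_iff_matching)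
qed

lemma card_partial_transversal_le_support:
  assumes "partial_transversal r A X"
  shows "card X \<le> card (support r A X)"
proof -
  obtain \<phi> where \<phi>: "matching r A X \<phi>"
    using assms by (auto simp: partial_transversal_iff_matching)
  then have "card (\<phi> ` X) \<le> card (support r A X)"
    by (intro card_mono finite_support matching_image_subset_support)
  then show ?thesis using card_matching_image[OF \<phi>] by simp
qed

lemma card_partial_transversal_le:
  assumes "partial_transversal r A X"
  shows "card X \<le> r"
  using card_partial_transversal_le_support[OF assms]
    card_mono[OF finite_atLeastAtMost support_subset, of r A X] by simp

lemma partial_transversal_insert:
  assumes "partial_transversal r A X" and "sys_le r A B"
    and "i \<in> {1..r} - support r A X" and "x \<in> B i"
  shows "partial_transversal r B (insert x X)"
proof -
  obtain \<phi> where \<phi>: "matching r A X \<phi>"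
    using assms(1) by (auto simp: partial_transversal_iff_matching)
  show ?thesis
  proof (rule partial_transversal_insert_matching)
    show "matching r B X \<phi>" by (rule matching_mono[OF \<phi> assms(2)])
    show "i \<in> {1..r} - \<phi> ` X" using matching_image_subset_support[OF \<phi>] assms(3) by blast
  qed (rule assms(4))
qed

lemma partial_transversal_insert_universal:
  assumes "partial_transversal r A X" and "card X < r" and "\<And>i. i \<in> {1..r} \<Longrightarrow> x \<in> A i"
  shows "partial_transversal r A (insert x X)"
proof -
  obtain \<phi> where \<phi>: "matching r A X \<phi>"
    using assms(1) by (auto simp: partial_transversal_iff_matching)
  have "\<phi> ` X \<noteq> {1..r}" using card_matching_image[OF \<phi>] assms(2) by auto
  moreover have "\<phi> ` X \<subseteq> {1..r}" using \<phi> by (simp add: matching_def)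
  ultimately obtain i where i: "i \<in> {1..r} - \<phi> ` X"
    using psubset_imp_ex_mem[of "\<phi> ` X" "{1..r}"] by auto
  then have "x \<in> A i" using assms(3) by simp
  then show ?thesis by (rule partial_transversal_insert_matching[OF \<phi> i])
qed

lemma partial_transversal_Un_universal:
  assumes "finite Z" and "finite X" and "partial_transversal r A X" and "card (X \<union> Z) \<le> r"
    and "\<And>e i. e \<in> Z \<Longrightarrow> i \<in> {1..r} \<Longrightarrow> e \<in> A i"
  shows "partial_transversal r A (X \<union> Z)"
  using assms
proof (induction Z rule: finite_induct)
  case empty
  then show ?case by simp
next
  case (insert z Z)
  show ?case
  proof (cases "z \<in> X \<union> Z")
    case True
    then show ?thesis using insert by (simp add: insert_absorb)
  next
    case False
    then have "card (X \<union> Z) < r" using insert by simp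
    then show ?thesis
      using partial_transversal_insert_universal[of r A "X \<union> Z" z] insert by simp
  qed
qed

lemma partial_transversal_representatives:
  assumes "inj_on \<iota> K" and "K \<subseteq> {1..r}" and "\<And>i. i \<in> K \<Longrightarrow> \<iota> i \<in> A i"
  shows "partial_transversal r A (\<iota> ` K)"
proof -
  have "matching r A (\<iota> ` K) (inv_into K \<iota>)"
    using assms by (auto simp: matching_def inj_on_inv_into)
  then show ?thesis by (auto simp: partial_transversal_iff_matching)
qed

subsection \<open>Presentations\<close>

lemma ground_transversal_matroid [simp]: "ground (transversal_matroid E r A) = E"
  by (simp add: ground_def transversal_matroid_def)

lemma mem_indeps_transversal_matroid:
  "X \<in> indeps (transversal_matroid E r A) \<longleftrightarrow> X \<subseteq> E \<and> partial_transversal r A X"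
  by (simp add: indeps_def transversal_matroid_def)

lemma presentation_imp_is_matroid: "presentation r A M \<Longrightarrow> is_matroid M"
  using is_matroid_transversal_matroid[of "ground M" r A] by (simp add: presentation_def)

lemma presentation_imp_is_transversal_matroid: "presentation r A M \<Longrightarrow> is_transversal_matroid M"
  by (auto simp: presentation_def is_transversal_matroid_def)

lemma presentation_transversal_matroid:
  assumes "set_system E r A" and "T \<subseteq> E" and "partial_transversal r A T" and "card T = r"
  shows "presentation r A (transversal_matroid E r A)"
proof -
  let ?M = "transversal_matroid E r A"
  have "Max (card ` indeps ?M) = r"
  proof (rule Max_eqI)
    have "indeps ?M \<subseteq> Pow E" by (auto simp: mem_indeps_transversal_matroid)
    then show "finite (card ` indeps ?M)"
      using assms(1) by (auto simp: set_system_def intro: finite_subset)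
    show "n \<le> r" if "n \<in> card ` indeps ?M" for n
      using that card_partial_transversal_le by (auto simp: mem_indeps_transversal_matroid)
    show "r \<in> card ` indeps ?M"
      using assms by (auto simp: mem_indeps_transversal_matroid image_iff)
  qed
  then show ?thesis using assms(1) by (simp add: presentation_def mrank_def)
qed

lemma transversal_matroid_eq_uniform_matroid:
  assumes "finite E" and "partial_transversal r A T"
    and "\<And>e i. e \<in> E - T \<Longrightarrow> i \<in> {1..r} \<Longrightarrow> e \<in> A i"
  shows "transversal_matroid E r A = uniform_matroid r E"
proof -
  have "partial_transversal r A X" if "X \<subseteq> E" "card X \<le> r" for X
  proof -
    have "finite X" using that(1) assms(1) by (rule finite_subset)
    moreover have "partial_transversal r A (X \<inter> T)"
      using assms(2) by (rule partial_transversal_subset) simp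
    moreover have "X \<inter> T \<union> (X - T) = X" by blast
    ultimately show ?thesis
      using partial_transversal_Un_universal[of "X - T" "X \<inter> T" r A] that assms(3) by auto
  qed
  then show ?thesis
    using card_partial_transversal_le by (auto simp: transversal_matroid_def uniform_matroid_def)
qed

subsection \<open>Saturated complements\<close>

definition saturates :: "nat \<Rightarrow> (nat \<Rightarrow> 'a set) \<Rightarrow> 'a set \<Rightarrow> 'a set \<Rightarrow> bool" where
  "saturates r A T F \<longleftrightarrow> T \<subseteq> F \<and> partial_transversal r A T \<and> card T = card (support r A F)"

lemma saturates_not_insert:
  assumes "saturates r A T F" and "finite F" and "e \<in> F" and "e \<notin> T"
  shows "\<not> partial_transversal r A (insert e T)"
proof
  assume "partial_transversal r A (insert e T)"
  then have "card (insert e T) \<le> card (support r A (insert e T))"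
    by (rule card_partial_transversal_le_support)
  also have "\<dots> \<le> card (support r A F)"
    using assms by (intro card_mono finite_support support_mono) (simp add: saturates_def)
  finally show False
    using assms finite_subset[of T F] by (simp add: saturates_def)
qed

lemma maximal_presentationI:
  assumes pres: "presentation r A M"
    and sat: "\<And>k e. k \<in> {1..r} \<Longrightarrow> e \<in> ground M - A k \<Longrightarrow>
      \<exists>T. saturates r A T (ground M - A k) \<and> e \<notin> T"
  shows "maximal_presentation r A M"
  unfolding maximal_presentation_def
proof (intro conjI allI impI ballI pres)
  fix B k assume "presentation r B M \<and> sys_le r A B" and k: "k \<in> {1..r}"
  then have B: "presentation r B M" and le: "sys_le r A B" by simp_all
  let ?F = "ground M - A k"
  have fin: "finite ?F" using pres by (simp add: presentation_def set_system_def)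
  have indeps: "X \<in> indeps M \<longleftrightarrow> X \<subseteq> ground M \<and> partial_transversal r C X"
    if "presentation r C M" for C X
    using that mem_indeps_transversal_matroid[of X "ground M" r C] by (simp add: presentation_def)
  have "B k \<subseteq> A k"
  proof (rule ccontr)
    assume "\<not> B k \<subseteq> A k"
    moreover have "B k \<subseteq> ground M" using B k by (simp add: presentation_def set_system_def)
    ultimately obtain e where e: "e \<in> B k" "e \<in> ?F" by blast
    obtain T where T: "saturates r A T ?F" "e \<notin> T" using sat[OF k e(2)] by blast
    have "partial_transversal r A T" "T \<subseteq> ?F" using T(1) by (simp_all add: saturates_def)
    moreover have "k \<in> {1..r} - support r A T"
      using k \<open>T \<subseteq> ?F\<close> by (auto simp: support_def)
    ultimately have "partial_transversal r B (insert e T)"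
      using partial_transversal_insert[OF _ le _ e(1)] by blast
    then have "partial_transversal r A (insert e T)"
      using indeps[OF B] indeps[OF pres] e(2) \<open>T \<subseteq> ?F\<close> by blast
    then show False using saturates_not_insert[OF T(1) fin e(2) T(2)] by blast
  qed
  then show "B k = A k" using le k by (auto simp: sys_le_def)
qed

subsection \<open>Coloops and closed sets\<close>

lemma is_matroid_deletion:
  assumes "is_matroid M"
  shows "is_matroid (deletion M D)"
proof -
  have "is_matroid (ground M - D, {X. X \<subseteq> ground M - D \<and> X \<in> indeps M})"
    using assms[unfolded is_matroid_def] by (intro is_matroidI) (simp, blast+)
  then show ?thesis by (simp add: deletion_def conj_commute)
qed

lemma indeps_imp_subset_basis:
  assumes "is_matroid M" and "X \<in> indeps M"
  obtains B where "is_basis M B" and "X \<subseteq> B"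
proof -
  have "finite (indeps M)"
    using assms(1) by (auto simp: is_matroid_def intro: finite_subset)
  then obtain B where "B \<in> indeps M" "X \<subseteq> B" "\<forall>B'\<in>indeps M. B \<subseteq> B' \<longrightarrow> B = B'"
    using finite_has_maximal2[OF _ assms(2)] by blast
  then show thesis using that[of B] by (auto simp: is_basis_def)
qed

lemma coloop_iff_insert_indeps:
  assumes "is_matroid M"
  shows "coloop M e \<longleftrightarrow> e \<in> ground M \<and> (\<forall>X\<in>indeps M. insert e X \<in> indeps M)"
proof (intro iffI conjI ballI)
  fix X assume "coloop M e" and "X \<in> indeps M"
  then obtain B where "is_basis M B" "X \<subseteq> B" "e \<in> B"
    using indeps_imp_subset_basis[OF assms] by (auto simp: coloop_def)
  then have "B \<in> indeps M" "insert e X \<subseteq> B" by (simp_all add: is_basis_def)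
  then show "insert e X \<in> indeps M" using assms unfolding is_matroid_def by blast
next
  assume e: "e \<in> ground M \<and> (\<forall>X\<in>indeps M. insert e X \<in> indeps M)"
  have "e \<in> B" if "is_basis M B" for B
    using that e unfolding is_basis_def by (metis insertI1 subset_insertI)
  then show "coloop M e" using e by (simp add: coloop_def)
qed (simp add: coloop_def)

lemma set_system_extend_system:
  "set_system E r A \<Longrightarrow> set_system (insert x E) r (extend_system x I A)"
  by (auto simp: set_system_def extend_system_def)

lemma sys_le_refl: "sys_le r A A"
  by (simp add: sys_le_def)

lemma sys_le_extend_system: "sys_le r A (extend_system x I A)"
  by (auto simp: sys_le_def extend_system_def)

lemma support_extend_system:
  "x \<notin> X \<Longrightarrow> support r (extend_system x I A) X = support r A X"
  by (auto simp: support_def extend_system_def)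

lemma partial_transversal_insert_extend_system:
  assumes "partial_transversal r (extend_system x I A) X" and "X \<subseteq> insert x F"
    and "i \<in> I" and "i \<in> {1..r} - support r A F"
  shows "partial_transversal r (extend_system x I A) (insert x X)"
proof (cases "x \<in> X")
  case True
  then show ?thesis using assms(1) by (simp add: insert_absorb)
next
  case False
  then have "X \<subseteq> F" using assms(2) by blast
  then have "support r (extend_system x I A) X \<subseteq> support r A F"
    using support_mono[of X F] False by (simp add: support_extend_system)
  then have "i \<in> {1..r} - support r (extend_system x I A) X" using assms(4) by blast
  moreover have "x \<in> extend_system x I A i" using assms(3) by (simp add: extend_system_def)
  ultimately show ?thesis by (rule partial_transversal_insert[OF assms(1) sys_le_refl])
qed

lemma saturates_extend_system:
  assumes "set_system E r A" and "x \<notin> E" and "I \<subseteq> support r A F" and "saturates r A T F"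
  shows "saturates r (extend_system x I A) T (insert x F)"
proof -
  have "x \<notin> A i" if "i \<in> {1..r}" for i using assms(1,2) that by (auto simp: set_system_def)
  then have "support r (extend_system x I A) (insert x F) = support r A F"
    using assms(3) by (auto simp: support_def extend_system_def split: if_splits)
  then show ?thesis
    using assms(4) partial_transversal_mono[OF _ sys_le_extend_system]
    by (auto simp: saturates_def)
qed

lemma coloop_deletion_extend_system_iff:
  assumes A: "set_system E r A" and x: "x \<notin> E" and D: "D \<subseteq> E" and I: "I \<subseteq> {1..r}"
    and T: "saturates r A T (E - D)"
  shows "coloop (deletion (transversal_matroid (insert x E) r (extend_system x I A)) D) x
    \<longleftrightarrow> \<not> I \<subseteq> support r A (E - D)"
proof -
  let ?A = "extend_system x I A" and ?F = "E - D"
  let ?N = "deletion (transversal_matroid (insert x E) r ?A) D"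
  have matroid: "is_matroid ?N"
    by (intro is_matroid_deletion is_matroid_transversal_matroid set_system_extend_system A)
  have ground: "ground ?N = insert x ?F"
    using x D by (auto simp: deletion_def ground_def transversal_matroid_def)
  have indeps: "X \<in> indeps ?N \<longleftrightarrow> X \<subseteq> insert x ?F \<and> partial_transversal r ?A X" for X
    using x D by (auto simp: deletion_def ground_def transversal_matroid_def indeps_def)
  have coloop: "coloop ?N x \<longleftrightarrow> (\<forall>X\<in>indeps ?N. insert x X \<in> indeps ?N)"
    using ground by (simp add: coloop_iff_insert_indeps[OF matroid])
  show ?thesis
  proof
    assume x_coloop: "coloop ?N x"
    show "\<not> I \<subseteq> support r A ?F"
    proof
      assume "I \<subseteq> support r A ?F"
      then have sat: "saturates r ?A T (insert x ?F)" by (rule saturates_extend_system[OF A x _ T])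
      have "x \<notin> T" using T x by (auto simp: saturates_def)
      moreover have "finite (insert x ?F)" using A by (simp add: set_system_def)
      ultimately have "insert x T \<notin> indeps ?N"
        using saturates_not_insert[OF sat] by (simp add: indeps)
      moreover have "T \<in> indeps ?N" using sat by (simp add: indeps saturates_def)
      ultimately show False using x_coloop coloop by blast
    qed
  next
    assume "\<not> I \<subseteq> support r A ?F"
    then obtain i where i: "i \<in> I" "i \<in> {1..r} - support r A ?F" using I by blast
    have "insert x X \<in> indeps ?N" if "X \<in> indeps ?N" for X
      using that partial_transversal_insert_extend_system[OF _ _ i] by (simp add: indeps)
    then show "coloop ?N x" using coloop by blast
  qed
qed

lemma closed_sets_eq_support:
  assumes A: "set_system E r A" and x: "x \<notin> E"
    and sat: "\<And>k. k \<in> {1..r} \<Longrightarrow> \<exists>T. saturates r A T (E - A k)"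
  shows "closed_sets E r x A =
    {I. I \<subseteq> {1..r} \<and> (\<forall>k\<in>{1..r} - I. I \<subseteq> support r A (E - A k))}"
proof -
  have coloop:
    "coloop (deletion (transversal_matroid (insert x E) r (extend_system x I A)) (A k)) x
      \<longleftrightarrow> \<not> I \<subseteq> support r A (E - A k)" if I: "I \<subseteq> {1..r}" and k: "k \<in> {1..r}" for I k
  proof -
    obtain T where T: "saturates r A T (E - A k)" using sat[OF k] by blast
    have "A k \<subseteq> E" using A k by (simp add: set_system_def)
    then show ?thesis by (rule coloop_deletion_extend_system_iff[OF A x _ I T])
  qed
  have "sigma_op E r x A I = I \<longleftrightarrow> (\<forall>k\<in>{1..r} - I. I \<subseteq> support r A (E - A k))"
    if "I \<subseteq> {1..r}" for I
  proof -
    have "sigma_op E r x A I = I \<union> {k \<in> {1..r} - I. \<not> I \<subseteq> support r A (E - A k)}"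
      unfolding sigma_op_def using coloop[OF that] by (simp cong: conj_cong)
    then show ?thesis by blast
  qed
  then show ?thesis unfolding closed_sets_def by (simp cong: conj_cong)
qed

subsection \<open>Lattices of sets\<close>

locale bounded_subset_lattice =
  fixes r :: nat and L :: "nat set set"
  assumes sublattice: "sublattice_of_subsets r L"
    and empty_in: "{} \<in> L" and full_in: "{1..r} \<in> L"
begin

abbreviation lattice_hull :: "nat set \<Rightarrow> nat set" where
  "lattice_hull I \<equiv> (\<lambda>K. K \<in> L) hull I"

definition greatest_avoiding :: "nat \<Rightarrow> nat set" where
  "greatest_avoiding k = \<Union>{K \<in> L. k \<notin> K}"

lemma Int_in: "I \<in> L \<Longrightarrow> J \<in> L \<Longrightarrow> I \<inter> J \<in> L"
  and Un_in: "I \<in> L \<Longrightarrow> J \<in> L \<Longrightarrow> I \<union> J \<in> L"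
  and subset_full: "I \<in> L \<Longrightarrow> I \<subseteq> {1..r}"
  using sublattice by (auto simp: sublattice_of_subsets_def)

lemma finite_L: "finite L"
  by (rule finite_subset[of _ "Pow {1..r}"]) (use subset_full in auto)

lemma lattice_hull_in:
  assumes "I \<subseteq> {1..r}"
  shows "lattice_hull I \<in> L"
proof -
  have "\<Inter>{K \<in> L. I \<subseteq> K} \<in> {K \<in> L. I \<subseteq> K}"
    using assms full_in Int_in finite_L by (intro finite_Inf_in) auto
  then show ?thesis by (simp add: hull_def)
qed

lemma greatest_avoiding_in: "greatest_avoiding k \<in> {K \<in> L. k \<notin> K}"
  unfolding greatest_avoiding_def
  using empty_in Un_in finite_L by (intro finite_Sup_in) auto

lemma greatest_avoiding_subset: "greatest_avoiding k \<subseteq> {1..r}"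
  using greatest_avoiding_in subset_full by blast

lemma hull_subset_greatest_avoiding:
  "I \<subseteq> greatest_avoiding k \<Longrightarrow> lattice_hull I \<subseteq> greatest_avoiding k"
  using greatest_avoiding_in by (intro hull_minimal) simp_all

lemma subset_greatest_avoiding: "K \<in> L \<Longrightarrow> k \<notin> K \<Longrightarrow> K \<subseteq> greatest_avoiding k"
  by (auto simp: greatest_avoiding_def)

lemma mem_iff_subset_greatest_avoiding:
  "I \<in> L \<longleftrightarrow> I \<subseteq> {1..r} \<and> (\<forall>k\<in>{1..r} - I. I \<subseteq> greatest_avoiding k)"
proof (intro iffI conjI ballI)
  assume I: "I \<subseteq> {1..r} \<and> (\<forall>k\<in>{1..r} - I. I \<subseteq> greatest_avoiding k)"
  then have hull: "lattice_hull I \<in> L" by (intro lattice_hull_in) simp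
  have "k \<in> I" if k: "k \<in> lattice_hull I" for k
  proof (rule ccontr)
    assume "k \<notin> I"
    then have "I \<subseteq> greatest_avoiding k" using I k subset_full[OF hull] by blast
    then have "lattice_hull I \<subseteq> greatest_avoiding k" by (rule hull_subset_greatest_avoiding)
    then show False using k greatest_avoiding_in by blast
  qed
  then have "lattice_hull I = I" by (intro equalityI hull_subset subsetI)
  then show "I \<in> L" using hull by simp
qed (use subset_full subset_greatest_avoiding in blast)+

end

subsection \<open>Labelled set systems\<close>

definition system_of_labels :: "'a set \<Rightarrow> ('a \<Rightarrow> nat set) \<Rightarrow> nat \<Rightarrow> 'a set" where
  "system_of_labels E V i = {e \<in> E. i \<in> V e}"

lemma mem_system_of_labels [simp]: "e \<in> system_of_labels E V i \<longleftrightarrow> e \<in> E \<and> i \<in> V e"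
  by (simp add: system_of_labels_def)

locale lattice_labelling = bounded_subset_lattice +
  fixes E :: "'a set" and V :: "'a \<Rightarrow> nat set"
  assumes finite_ground: "finite E" and label_in: "e \<in> E \<Longrightarrow> V e \<in> L"
begin

abbreviation A :: "nat \<Rightarrow> 'a set" where
  "A \<equiv> system_of_labels E V"

definition hull_representatives :: "(nat \<Rightarrow> 'a) \<Rightarrow> bool" where
  "hull_representatives \<iota> \<longleftrightarrow>
     inj_on \<iota> {1..r} \<and> (\<forall>i\<in>{1..r}. \<iota> i \<in> E \<and> V (\<iota> i) = lattice_hull {i})"

lemma set_system_of_labels: "set_system E r A"
  using finite_ground by (auto simp: set_system_def)

lemma hull_representative_mem:
  "hull_representatives \<iota> \<Longrightarrow> i \<in> {1..r} \<Longrightarrow> \<iota> i \<in> A i"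
  using hull_inc[of i "{i}"] by (simp add: hull_representatives_def)

lemma hull_representative_notin:
  assumes "hull_representatives \<iota>" and "i \<in> greatest_avoiding k"
  shows "\<iota> i \<in> E - A k"
proof -
  have "lattice_hull {i} \<subseteq> greatest_avoiding k"
    using assms(2) by (intro hull_subset_greatest_avoiding) simp
  then have "k \<notin> lattice_hull {i}" using greatest_avoiding_in by blast
  moreover have "i \<in> {1..r}" using assms(2) greatest_avoiding_subset by blast
  ultimately show ?thesis using assms(1) by (simp add: hull_representatives_def)
qed

lemma partial_transversal_hull_representatives:
  assumes "hull_representatives \<iota>" and "K \<subseteq> {1..r}"
  shows "partial_transversal r A (\<iota> ` K)"
proof (rule partial_transversal_representatives[OF _ assms(2)])
  show "inj_on \<iota> K"
    using assms inj_on_subset by (auto simp: hull_representatives_def)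
  show "\<iota> i \<in> A i" if "i \<in> K" for i
    using that assms hull_representative_mem by blast
qed

lemma card_hull_representatives:
  "hull_representatives \<iota> \<Longrightarrow> K \<subseteq> {1..r} \<Longrightarrow> card (\<iota> ` K) = card K"
  by (auto simp: hull_representatives_def intro: card_image inj_on_subset)

lemma presentation_system_of_labels:
  assumes "hull_representatives \<iota>"
  shows "presentation r A (transversal_matroid E r A)"
proof (rule presentation_transversal_matroid[OF set_system_of_labels])
  show "\<iota> ` {1..r} \<subseteq> E" using assms by (auto simp: hull_representatives_def)
  show "partial_transversal r A (\<iota> ` {1..r})"
    by (rule partial_transversal_hull_representatives[OF assms order_refl])
  show "card (\<iota> ` {1..r}) = r" using card_hull_representatives[OF assms] by simp
qed

lemma support_complement:
  assumes "hull_representatives \<iota>"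
  shows "support r A (E - A k) = greatest_avoiding k"
proof (intro equalityI subsetI)
  fix i assume "i \<in> support r A (E - A k)"
  then obtain e where "e \<in> E" "k \<notin> V e" "i \<in> V e" by (auto simp: support_def)
  then show "i \<in> greatest_avoiding k"
    using subset_greatest_avoiding[OF label_in] by blast
next
  fix i assume i: "i \<in> greatest_avoiding k"
  then have "i \<in> {1..r}" using greatest_avoiding_subset by blast
  then show "i \<in> support r A (E - A k)"
    using hull_representative_mem[OF assms] hull_representative_notin[OF assms i]
    unfolding support_def by blast
qed

lemma saturates_hull_representatives:
  assumes "hull_representatives \<iota>"
  shows "saturates r A (\<iota> ` greatest_avoiding k) (E - A k)"
  unfolding saturates_def support_complement[OF assms]
  using partial_transversal_hull_representatives[OF assms greatest_avoiding_subset]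
    card_hull_representatives[OF assms greatest_avoiding_subset]
    hull_representative_notin[OF assms]
  by blast

lemma closed_sets_system_of_labels:
  assumes "hull_representatives \<iota>" and "x \<notin> E"
  shows "closed_sets E r x A = L"
proof -
  have "closed_sets E r x A =
      {I. I \<subseteq> {1..r} \<and> (\<forall>k\<in>{1..r} - I. I \<subseteq> support r A (E - A k))}"
    using saturates_hull_representatives[OF assms(1)]
    by (intro closed_sets_eq_support[OF set_system_of_labels assms(2)] exI)
  also have "\<dots> = L"
    using mem_iff_subset_greatest_avoiding by (auto simp only: support_complement[OF assms(1)])
  finally show ?thesis .
qed

lemma maximal_presentation_system_of_labels:
  assumes avoid: "\<And>e. \<exists>\<iota>. hull_representatives \<iota> \<and> e \<notin> \<iota> ` {1..r}"
  shows "maximal_presentation r A (transversal_matroid E r A)"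
proof (rule maximal_presentationI)
  show "presentation r A (transversal_matroid E r A)"
    using avoid presentation_system_of_labels by blast
  fix k e
  obtain \<iota> where \<iota>: "hull_representatives \<iota>" "e \<notin> \<iota> ` {1..r}" using avoid by blast
  then have "e \<notin> \<iota> ` greatest_avoiding k" using greatest_avoiding_subset by blast
  then show "\<exists>T. saturates r A T (ground (transversal_matroid E r A) - A k) \<and> e \<notin> T"
    using saturates_hull_representatives[OF \<iota>(1)] unfolding ground_transversal_matroid by blast
qed

end

context bounded_subset_lattice
begin

lemma ex_maximal_presentation_closed_sets_eq:
  fixes E :: "'a set" and c :: "'a \<Rightarrow> nat"
  assumes "finite E" and "c ` E \<subseteq> {1..r}"
    and copies: "\<And>e i. i \<in> {1..r} \<Longrightarrow> \<exists>e'\<in>E - {e}. c e' = i"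
  shows "\<exists>A. maximal_presentation r A (transversal_matroid E r A) \<and>
    (\<forall>x. x \<notin> E \<longrightarrow> closed_sets E r x A = L)"
proof -
  interpret lattice_labelling r L E "\<lambda>e. lattice_hull {c e}"
  proof
    show "lattice_hull {c e} \<in> L" if "e \<in> E" for e
      using that assms(2) by (intro lattice_hull_in) auto
  qed (rule assms(1))
  have "\<exists>\<iota>. hull_representatives \<iota> \<and> e \<notin> \<iota> ` {1..r}" for e
  proof -
    have "\<forall>i\<in>{1..r}. \<exists>e'. e' \<in> E - {e} \<and> c e' = i" using copies by blast
    from bchoice[OF this] obtain \<iota> where
      \<iota>: "\<forall>i\<in>{1..r}. \<iota> i \<in> E - {e} \<and> c (\<iota> i) = i" by blast
    then have "inj_on \<iota> {1..r}" by (intro inj_on_inverseI[of _ c]) simp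
    then have "hull_representatives \<iota>" using \<iota> by (simp add: hull_representatives_def)
    then show ?thesis using \<iota> by blast
  qed
  then show ?thesis
    using maximal_presentation_system_of_labels closed_sets_system_of_labels by blast
qed

lemma ex_uniform_presentation_closed_sets_eq:
  fixes E :: "'a set"
  assumes "finite E" and "r \<le> card E"
  shows "\<exists>B. presentation r B (uniform_matroid r E) \<and> (\<forall>x. x \<notin> E \<longrightarrow> closed_sets E r x B = L)"
proof -
  obtain \<iota> where \<iota>: "inj_on \<iota> {1..r}" "\<iota> ` {1..r} \<subseteq> E"
    using card_le_inj[of "{1..r}" E] assms by auto
  define V where
    "V e = (if e \<in> \<iota> ` {1..r} then lattice_hull {inv_into {1..r} \<iota> e} else {1..r})" for e
  interpret lattice_labelling r L E V
  proof
    show "V e \<in> L" for e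
      using inv_into_into[of e \<iota> "{1..r}"] full_in by (auto simp: V_def intro!: lattice_hull_in)
  qed (rule assms(1))
  have reps: "hull_representatives \<iota>"
    using \<iota> by (auto simp: hull_representatives_def V_def)
  have "transversal_matroid E r A = uniform_matroid r E"
  proof (rule transversal_matroid_eq_uniform_matroid[OF assms(1)])
    show "partial_transversal r A (\<iota> ` {1..r})"
      by (rule partial_transversal_hull_representatives[OF reps order_refl])
    show "e \<in> A i" if "e \<in> E - \<iota> ` {1..r}" "i \<in> {1..r}" for e i
      using that by (simp add: V_def)
  qed
  then have "presentation r A (uniform_matroid r E)"
    using presentation_system_of_labels[OF reps] by simp
  then show ?thesis using closed_sets_system_of_labels[OF reps] by blast
qed

end

theorem theorem3p19:
  fixes r :: nat and L :: "nat set set"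
  assumes "sublattice_of_subsets r L"
    and "{} \<in> L" and "{1..r} \<in> L"
  shows "(\<exists>M :: nat matroid_data. is_matroid M \<and> is_transversal_matroid M \<and> mrank M = r \<and>
            (\<exists>A. maximal_presentation r A M \<and>
                 (\<forall>x. x \<notin> ground M \<longrightarrow> L = closed_sets (ground M) r x A)))
       \<and> (\<forall>n\<ge>r. \<forall>E :: 'a set. finite E \<and> card E = n \<longrightarrow>
            (\<exists>B. presentation r B (uniform_matroid r E) \<and>
                 (\<forall>x. x \<notin> E \<longrightarrow> L = closed_sets E r x B)))"
proof (intro conjI allI impI)
  interpret bounded_subset_lattice r L by unfold_locales (rule assms)+
  \<comment> \<open>the two copies of \<open>e\<^sub>i\<close> are \<open>2 * i\<close> and \<open>2 * i + 1\<close>\<close>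
  define E :: "nat set" where "E = {2..2 * r + 1}"
  have "finite E" and "(\<lambda>e. e div 2) ` E \<subseteq> {1..r}" by (auto simp: E_def)
  moreover have "\<exists>e'\<in>E - {e}. e' div 2 = i" if "i \<in> {1..r}" for e i
    using that by (intro bexI[of _ "if e = 2 * i then 2 * i + 1 else 2 * i"]) (auto simp: E_def)
  ultimately obtain A where A: "maximal_presentation r A (transversal_matroid E r A)"
      "\<forall>x. x \<notin> E \<longrightarrow> closed_sets E r x A = L"
    using ex_maximal_presentation_closed_sets_eq[of E "\<lambda>e. e div 2"] by blast
  then have pres: "presentation r A (transversal_matroid E r A)"
    by (simp add: maximal_presentation_def)
  then have "mrank (transversal_matroid E r A) = r" by (simp add: presentation_def)
  then show "\<exists>M :: nat matroid_data. is_matroid M \<and> is_transversal_matroid M \<and> mrank M = r \<and>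
      (\<exists>A. maximal_presentation r A M \<and>
        (\<forall>x. x \<notin> ground M \<longrightarrow> L = closed_sets (ground M) r x A))"
    using presentation_imp_is_matroid[OF pres] presentation_imp_is_transversal_matroid[OF pres] A
    by (intro exI[of _ "transversal_matroid E r A"] exI[of _ A] conjI) simp_all
  fix n :: nat and E :: "'a set" assume "r \<le> n" and "finite E \<and> card E = n"
  then show "\<exists>B. presentation r B (uniform_matroid r E) \<and>
      (\<forall>x. x \<notin> E \<longrightarrow> L = closed_sets E r x B)"
    using ex_uniform_presentation_closed_sets_eq[of E] by blast
qed

end
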